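(* Let $p$ be any prime and let $n$ be a positive integer. (i) For any $\alpha,h,l,m\in\mathbb N$, we have $$\operatorname{ord}_p\left(m!\sum_{k=0}^{l}\binom lk(-1)^kS\bigl(kh(p-1)p^{\alpha}+n-1,\,m\bigr)\right)\ \ge\ \min\left\{l(\alpha+1),\ n-1+\operatorname{ord}_p\left(\left\lfloor\frac mp\right\rfloor!\right)\right\}.$$ (ii) If we define $N=n-1+\lfloor n/(p(p-1))\rfloor$, then $$e_p\bigl(n,(p-1)p^L+n-1\bigr)\ \ge\ n-1+\operatorname{ord}_p\left(\left\lfloor\frac np\right\rfloor!\right)\qquad\text{for } L=N,N+1,\ldots.$$
   Context: $\mathbb N=\{0,1,2,\ldots\}$. For a prime $p$ and an integer $m$, $\operatorname{ord}_p(m)=\sup\{a\in\mathbb N: p^a\mid m\}$ (so $\operatorname{ord}_p(0)=+\infty$). $S(n,k)$, for $n,k\in\mathbb N$, is the Stirling number of the second kind: the number of partitions of a set of cardinality $n$ into $k$ nonempty subsets, with $S(0,0)=1$. For a prime $p$ and positive integers $k\ge n$, define $$e_p(n,k)=\min_{m\ge n}\operatorname{ord}_p\bigl(m!\,S(k,m)\bigr),$$ the minimum being over all integers $m\ge n$. *)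

theory Defs
  imports
    "HOL-Library.Extended_Nat"
    "HOL-Library.Disjoint_Sets"
    "HOL-Computational_Algebra.Primes"
    "HOL-Combinatorics.Stirling"
begin

text \<open>
  The library defines \<open>Stirling\<close> by its recurrence; \<open>Stirling_eq_card_partitions\<close>
  below identifies \<open>Stirling n k\<close> with the number of partitions of an \<open>n\<close>-element
  set into \<open>k\<close> nonempty blocks.
\<close>

lemma partitions_insert_Suc:
  assumes fin: "finite A" and a: "a \<notin> A"
  shows "{Q. partition_on (insert a A) Q \<and> card Q = Suc k} =
      insert {a} ` {P. partition_on A P \<and> card P = k} \<union>
      (\<lambda>(P, B). insert (insert a B) (P - {B})) `
        (SIGMA P : {P. partition_on A P \<and> card P = Suc k}. P)"
    (is "?L = ?R1 \<union> ?R2")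
proof (intro equalityI subsetI)
  fix Q assume "Q \<in> ?L"
  then have Q: "partition_on (insert a A) Q" and cQ: "card Q = Suc k" by auto
  have finQ: "finite Q" using cQ by (metis card.infinite nat.distinct(1))
  from Q obtain B where B: "B \<in> Q" "a \<in> B"
    by (auto simp: partition_on_def)
  have uniq: "a \<notin> C" if "C \<in> Q" "C \<noteq> B" for C
    using Q B that by (auto simp: partition_on_def disjoint_def)
  show "Q \<in> ?R1 \<union> ?R2"
  proof (cases "B = {a}")
    case True
    have "\<Union>(Q - {B}) = A"
    proof -
      have "\<Union>Q = insert a A" using Q by (simp add: partition_on_def)
      moreover have "\<Union>Q = insert a (\<Union>(Q - {B}))" using B True by auto
      moreover have "a \<notin> \<Union>(Q - {B})" using uniq by auto
      ultimately show ?thesis using a by (metis insert_ident)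
    qed
    then have "partition_on A (Q - {B})"
      using Q by (auto simp: partition_on_def disjoint_def)
    moreover have "card (Q - {B}) = k" using cQ B by simp
    moreover have "Q = insert {a} (Q - {B})" using B True by auto
    ultimately show ?thesis by blast
  next
    case False
    let ?B = "B - {a}" and ?P = "insert (B - {a}) (Q - {B})"
    have ne: "?B \<noteq> {}" using B False by auto
    have dis: "C \<inter> B = {}" if "C \<in> Q" "C \<noteq> B" for C
      using Q B that by (auto simp: partition_on_def disjoint_def)
    have notin: "?B \<notin> Q - {B}"
      using dis ne by blast
    have "\<Union>?P = A"
    proof -
      have "\<Union>Q = insert a A" using Q by (simp add: partition_on_def)
      moreover have "\<Union>Q = B \<union> \<Union>(Q - {B})" using B by auto
      moreover have "a \<notin> \<Union>(Q - {B})" using uniq by auto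
      ultimately show ?thesis using a B by auto
    qed
    moreover have "disjoint ?P"
    proof (rule disjointI)
      fix C D assume CD: "C \<in> ?P" "D \<in> ?P" "C \<noteq> D"
      have "X \<inter> Y = {}" if "X \<in> Q" "Y \<in> Q" "X \<noteq> Y" for X Y
        using Q that by (simp add: partition_on_def disjoint_def)
      then show "C \<inter> D = {}" using CD dis by fast
    qed
    moreover have "{} \<notin> ?P" using Q ne by (auto simp: partition_on_def)
    ultimately have P: "partition_on A ?P" by (simp add: partition_on_def)
    have "card ?P = Suc k" using notin finQ cQ B by simp
    moreover have "Q = insert (insert a ?B) (?P - {?B})"
      using B notin by (auto simp: insert_absorb)
    ultimately have "Q \<in> ?R2"
      using P by (intro image_eqI[where x = "(?P, ?B)"]) auto
    then show ?thesis by blast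
  qed
next
  fix Q assume "Q \<in> ?R1 \<union> ?R2"
  then show "Q \<in> ?L"
  proof
    assume "Q \<in> ?R1"
    then obtain P where P: "partition_on A P" "card P = k" "Q = insert {a} P" by auto
    have "finite P" using P fin finite_elements by blast
    moreover have "{a} \<notin> P" using P a by (auto simp: partition_on_def)
    ultimately show ?thesis using P a
      by (auto simp: partition_on_def disjoint_def)
  next
    assume "Q \<in> ?R2"
    then obtain P B where P: "partition_on A P" "card P = Suc k" "B \<in> P"
      and Q: "Q = insert (insert a B) (P - {B})" by auto
    have "finite P" using P fin finite_elements by blast
    moreover have "insert a B \<notin> P" using P a by (auto simp: partition_on_def)
    ultimately have "card Q = Suc k" using P Q by (simp add: card_gt_0_iff)
    moreover have "\<Union>Q = insert a A" using P Q by (auto simp: partition_on_def)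
    moreover have "disjoint Q"
    proof -
      have aC: "a \<notin> C" if "C \<in> P" for C using P a that by (auto simp: partition_on_def)
      have "C \<inter> D = {}" if "C \<in> P" "D \<in> P" "C \<noteq> D" for C D
        using P that by (auto simp: partition_on_def disjoint_def)
      note dis = this
      show ?thesis
      proof (rule disjointI)
        fix C D assume "C \<in> Q" "D \<in> Q" "C \<noteq> D"
        then consider "C \<in> P" "D \<in> P" | "C = insert a B" "D \<in> P" "D \<noteq> B"
          | "D = insert a B" "C \<in> P" "C \<noteq> B" unfolding Q by blast
        then show "C \<inter> D = {}"
        proof cases
          case 1 then show ?thesis using dis \<open>C \<noteq> D\<close> by blast
        next
          case 2 then show ?thesis using dis[of B D] aC[of D] P(3) by auto
        next
          case 3 then show ?thesis using dis[of C B] aC[of C] P(3) by auto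
        qed
      qed
    qed
    moreover have "{} \<notin> Q" using P Q by (auto simp: partition_on_def)
    ultimately show ?thesis by (simp add: partition_on_def)
  qed
qed

lemma Stirling_eq_card_partitions:
  fixes A :: "'a set"
  assumes "finite A"
  shows "Stirling (card A) k = card {P. partition_on A P \<and> card P = k}"
  using assms
proof (induction A arbitrary: k rule: finite_induct)
  case empty
  have "{P. partition_on ({} :: 'a set) P \<and> card P = k} = (if k = 0 then {{}} else {})"
  proof (rule set_eqI)
    fix P :: "'a set set"
    show "P \<in> {P. partition_on ({} :: 'a set) P \<and> card P = k} \<longleftrightarrow> P \<in> (if k = 0 then {{}} else {})"
      by (cases "P = {}") (simp_all add: partition_on_empty)
  qed
  note eq = this
  show ?case unfolding eq by (cases k) simp_all
next
  case (insert a A)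
  show ?case
  proof (cases k)
    case 0
    have "\<not> (partition_on (insert a A) P \<and> card P = 0)" for P
    proof
      assume P: "partition_on (insert a A) P \<and> card P = 0"
      then have "finite P" using insert.hyps finite_elements[of "insert a A" P] by simp
      then have "P = {}" using P by simp
      then show False using P by (simp add: partition_on_def)
    qed
    then have "{P. partition_on (insert a A) P \<and> card P = 0} = {}" by blast
    note eq = this
    show ?thesis unfolding 0 eq using insert.hyps by simp
  next
    case (Suc j)
    let ?S = "\<lambda>k. {P. partition_on A P \<and> card P = k}"
    let ?f = "\<lambda>(P, B). insert (insert a B) (P - {B})"
    have aC: "a \<notin> C" if "partition_on A P" "C \<in> P" for P C
      using that insert.hyps by (auto simp: partition_on_def)
    have finS: "finite (?S i)" for i
      using finitely_many_partition_on[OF insert.hyps(1)] by (rule finite_subset[rotated]) auto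
    have finP: "finite P" if "P \<in> ?S i" for P i
      using that insert.hyps finite_elements by blast
    have inj1: "inj_on (insert {a}) (?S j)"
    proof (rule inj_onI)
      fix P P' assume "P \<in> ?S j" "P' \<in> ?S j" "insert {a} P = insert {a} P'"
      moreover have "{a} \<notin> P" "{a} \<notin> P'" using aC calculation by blast+
      ultimately show "P = P'" by (simp add: insert_ident)
    qed
    have rec: "B = B' \<and> P = P'"
      if P: "partition_on A P" "B \<in> P" and P': "partition_on A P'" "B' \<in> P'"
        and eq: "insert (insert a B) (P - {B}) = insert (insert a B') (P' - {B'})" for P B P' B'
    proof -
      have "insert a B = insert a B'" using eq aC[OF P'(1)] by blast
      moreover have "a \<notin> B" "a \<notin> B'" using aC P P' by auto
      ultimately have BB: "B = B'" by (metis insert_ident)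
      have "insert a B \<notin> P" "insert a B \<notin> P'" using aC P P' by blast+
      then have "P - {B} = P' - {B}" using eq BB insert_ident[of "insert a B" "P - {B}" "P' - {B}"] by simp
      then show ?thesis using BB P P' by (metis insert_Diff)
    qed
    have inj2: "inj_on ?f (SIGMA P : ?S (Suc j). P)"
    proof (rule inj_onI)
      fix x y assume *: "x \<in> (SIGMA P : ?S (Suc j). P)" "y \<in> (SIGMA P : ?S (Suc j). P)"
        and **: "?f x = ?f y"
      obtain P B P' B' where xy: "x = (P, B)" "y = (P', B')" by (cases x, cases y)
      have "B = B' \<and> P = P'" using * ** unfolding xy by (intro rec) simp_all
      then show "x = y" using xy by simp
    qed
    have disj: "insert {a} ` ?S j \<inter> ?f ` (SIGMA P : ?S (Suc j). P) = {}"
    proof -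
      have False if "partition_on A P" "partition_on A P'" "B \<in> P'"
        and eq: "insert {a} P = insert (insert a B) (P' - {B})" for P P' B
      proof -
        have "{a} \<notin> P'" using aC that(2) by blast
        moreover have "{a} \<in> insert (insert a B) (P' - {B})" using eq by (metis insertI1)
        ultimately have "{a} = insert a B" by simp
        moreover have "a \<notin> B" "B \<noteq> {}" using aC that by (auto simp: partition_on_def)
        ultimately show False by blast
      qed
      then show ?thesis by (force simp: image_iff)
    qed
    have "card (SIGMA P : ?S (Suc j). P) = (\<Sum>P\<in>?S (Suc j). card P)"
      by (intro card_SigmaI finS ballI) (rule finP)
    also have "\<dots> = Suc j * card (?S (Suc j))" by simp
    finally have sig: "card (SIGMA P : ?S (Suc j). P) = Suc j * card (?S (Suc j))" .
    have "finite (SIGMA P : ?S (Suc j). P)"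
      by (intro finite_SigmaI finS) (rule finP)
    then have "card {Q. partition_on (insert a A) Q \<and> card Q = Suc j} =
        card (?S j) + Suc j * card (?S (Suc j))"
      unfolding partitions_insert_Suc[OF insert.hyps]
      by (simp only: card_Un_disjoint[OF finite_imageI[OF finS] finite_imageI disj]
          card_image[OF inj1] card_image[OF inj2] sig)
    note eq = this
    show ?thesis unfolding Suc eq using insert.hyps by (simp add: insert.IH)
  qed
qed

text \<open>
  The value \<open>\<infinity>\<close> occurs exactly at \<open>m = 0\<close> (for \<open>p > 1\<close>), unlike for the library's
  natural-number-valued \<open>multiplicity\<close>, which is \<open>0\<close> there.
\<close>

definition ord_p :: "nat \<Rightarrow> int \<Rightarrow> enat" where
  "ord_p p m = (SUP a \<in> {a. int p ^ a dvd m}. enat a)"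

text \<open>
  The type \<open>enat\<close> is well-ordered, so this infimum over a nonempty set is attained,
  i.e. it is a minimum. The definition is meant for \<open>1 \<le> n \<le> k\<close>.
\<close>

definition e_p :: "nat \<Rightarrow> nat \<Rightarrow> nat \<Rightarrow> enat" where
  "e_p p n k = (INF m \<in> {n..}. ord_p p (int (fact m * Stirling k m)))"

end

theory Submission
  imports Defs "HOL-Number_Theory.Residues" "HOL-Computational_Algebra.Polynomial"
begin

text \<open>
  Expanding \<open>m! S(-, m)\<close> as an alternating sum turns the sum in (i) into
  \<open>\<Sum>\<^sub>j \<plusminus>(m choose j) j ^ (n - 1) (1 - j ^ (h (p - 1) p ^ \<alpha>)) ^ l\<close>. Terms with
  \<open>p\<close> not dividing \<open>j\<close> are divisible by \<open>p ^ (l (\<alpha> + 1))\<close> by Euler's theorem. For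
  \<open>j = p i\<close> one splits off \<open>p ^ (n - 1)\<close>, leaving \<open>f(i)\<close> for an integer polynomial \<open>f\<close>. The
  sum of \<open>\<plusminus>(m choose p i) f(i)\<close> pairs the coefficients of \<open>(1 - y) ^ m\<close> with the sequence
  \<open>w(p i) = f(i)\<close>, zero off the multiples of \<open>p\<close>. Write \<open>(1 - y) ^ p = (1 - y ^ p) + p g\<close>
  and \<open>q = m div p\<close>, and expand the \<open>q\<close>-th power: the \<open>s\<close>-th term carries the factor
  \<open>(q choose s) p ^ (q - s)\<close>, and pairing with a multiple of \<open>(1 - y ^ p) ^ s\<close> takes \<open>s\<close>-th
  differences of \<open>f\<close>, which gives a further factor \<open>s!\<close>. Since \<open>(q - s)!\<close> contains at most
  \<open>q - s\<close> factors \<open>p\<close>, all terms are divisible by the \<open>p\<close>-part of \<open>q!\<close>.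

  Part (ii) is the case \<open>l = h = 1\<close>, \<open>\<alpha> = L\<close> of (i): the \<open>k = 0\<close> term vanishes as
  \<open>S(n - 1, m) = 0\<close> for \<open>m \<ge> n\<close>, and \<open>L + 1\<close> is large enough by Legendre's bound.
\<close>

section \<open>Stirling numbers and alternating binomial sums\<close>

text \<open>Both sides satisfy \<open>a (n + 1) m = m * (a n m + a n (m - 1))\<close> for
  \<open>m > 0\<close>; at \<open>n = 0\<close> the sum is \<open>(1 - 1) ^ m\<close> up to
  sign.\<close>

lemma fact_Stirling_eq_alternating_sum:
  "int (fact m * Stirling n m) = (\<Sum>j\<le>m. (- 1) ^ (m + j) * int (m choose j) * int j ^ n)"
proof (induction n arbitrary: m)
  case 0
  have "(\<Sum>j\<le>m. (- 1) ^ (m + j) * int (m choose j)) = (- 1) ^ m * (\<Sum>j\<le>m. (- 1) ^ j * int (m choose j))"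
    by (simp add: sum_distrib_left power_add mult.assoc)
  then show ?case
    by (cases "m = 0") (simp_all add: choose_alternating_sum)
next
  case (Suc n)
  show ?case
  proof (cases m)
    case 0
    then show ?thesis by simp
  next
    case (Suc i)
    \<comment> \<open>Absorption followed by Pascal's rule; at \<open>j = 0\<close> both sides
      vanish.\<close>
    have absorb: "int (Suc i choose j) * int j = int (Suc i) * (int (Suc i choose j) - int (i choose j))" for j
    proof (cases j)
      case (Suc j')
      have "Suc j' * (Suc i choose Suc j') = Suc i * (i choose j')"
        by (rule Suc_times_binomial)
      then show ?thesis
        unfolding Suc of_nat_mult[symmetric] mult.commute[of _ "Suc j'"]
        by (simp only: binomial_Suc_Suc of_nat_add of_nat_mult) simp
    qed simp
    \<comment> \<open>The added term is zero because \<open>i choose Suc i = 0\<close>; the two sums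
      now share a range.\<close>
    have extend: "(\<Sum>j\<le>i. (- 1) ^ (i + j) * int (i choose j) * int j ^ n)
        = (\<Sum>j\<le>Suc i. (- 1) ^ (i + j) * int (i choose j) * int j ^ n)"
      by simp
    have "(\<Sum>j\<le>Suc i. (- 1) ^ (Suc i + j) * int (Suc i choose j) * int j ^ Suc n)
        = (\<Sum>j\<le>Suc i. int (Suc i) * ((- 1) ^ (Suc i + j) * int (Suc i choose j) * int j ^ n
            + (- 1) ^ (i + j) * int (i choose j) * int j ^ n))"
    proof (rule sum.cong[OF refl])
      fix j
      have "(- 1) ^ (Suc i + j) * int (Suc i choose j) * int j ^ Suc n
          = (- 1) ^ (Suc i + j) * (int (Suc i choose j) * int j) * int j ^ n"
        by (simp only: power_Suc mult_ac)
      also have "\<dots> = int (Suc i) * ((- 1) ^ (Suc i + j) * int (Suc i choose j) * int j ^ n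
            + (- 1) ^ (i + j) * int (i choose j) * int j ^ n)"
        unfolding absorb by (simp add: algebra_simps del: binomial_Suc_Suc)
      finally show "(- 1) ^ (Suc i + j) * int (Suc i choose j) * int j ^ Suc n = \<dots>" .
    qed
    also have "\<dots> = int (Suc i) * (int (fact (Suc i) * Stirling n (Suc i)) + int (fact i * Stirling n i))"
      unfolding Suc.IH extend by (simp only: sum_distrib_left sum.distrib distrib_left)
    also have "\<dots> = int (fact (Suc i) * Stirling (Suc n) (Suc i))"
      by (simp add: algebra_simps)
    finally show ?thesis unfolding Suc by simp
  qed
qed

text \<open>By linearity it suffices to treat powers \<open>j ^ k\<close>, for which the sum is
  \<open>fact s * Stirling k s\<close> up to sign.\<close>

lemma fact_dvd_alternating_sum_poly:
  fixes f :: "int poly"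
  shows "fact s dvd (\<Sum>j\<le>s. (- 1) ^ j * int (s choose j) * poly f (int j))"
proof -
  have "fact s dvd (\<Sum>j\<le>s. (- 1) ^ j * int (s choose j) * int j ^ k)" for k
  proof -
    have "(\<Sum>j\<le>s. (- 1) ^ j * int (s choose j) * int j ^ k)
        = (- 1) ^ s * (\<Sum>j\<le>s. (- 1) ^ (s + j) * int (s choose j) * int j ^ k)"
      by (simp add: sum_distrib_left power_add mult.assoc flip: mult.assoc[of "(- 1) ^ s" "(- 1) ^ s"] power_mult_distrib)
    also have "\<dots> = fact s * ((- 1) ^ s * int (Stirling k s))"
      by (simp flip: fact_Stirling_eq_alternating_sum)
    finally show ?thesis by simp
  qed
  note power = this
  have "(\<Sum>j\<le>s. (- 1) ^ j * int (s choose j) * poly f (int j))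
      = (\<Sum>k\<le>degree f. coeff f k * (\<Sum>j\<le>s. (- 1) ^ j * int (s choose j) * int j ^ k))"
    unfolding poly_altdef sum_distrib_left
    by (subst sum.swap) (simp add: mult_ac)
  also have "fact s dvd \<dots>"
    by (intro dvd_sum dvd_mult power)
  finally show ?thesis .
qed

section \<open>Pairing a sequence with the coefficients of a polynomial\<close>

text \<open>The linear functional on integer polynomials that sends \<open>y ^ k\<close> to
  \<open>w k\<close>.\<close>

definition coeff_pairing :: "(nat \<Rightarrow> int) \<Rightarrow> int poly \<Rightarrow> int" where
  "coeff_pairing w F = (\<Sum>k\<le>degree F. coeff F k * w k)"

text \<open>Linearity needs a common summation range, since the degree of a sum can drop.\<close>

lemma coeff_pairing_bound:
  assumes "degree F \<le> d"
  shows "coeff_pairing w F = (\<Sum>k\<le>d. coeff F k * w k)"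
  unfolding coeff_pairing_def
  by (rule sum.mono_neutral_left) (use assms in \<open>auto simp: coeff_eq_0\<close>)

lemma coeff_pairing_0 [simp]: "coeff_pairing w 0 = 0"
  by (simp add: coeff_pairing_def)

lemma coeff_pairing_add: "coeff_pairing w (F + G) = coeff_pairing w F + coeff_pairing w G"
proof -
  define d where "d = max (degree F) (degree G)"
  have "degree (F + G) \<le> d" "degree F \<le> d" "degree G \<le> d"
    unfolding d_def by (simp_all add: degree_add_le)
  then show ?thesis
    by (simp add: coeff_pairing_bound[where d = d] sum.distrib distrib_right)
qed

lemma coeff_pairing_smult: "coeff_pairing w (smult c F) = c * coeff_pairing w F"
  by (simp add: coeff_pairing_bound[OF degree_smult_le] coeff_pairing_def[of w F] sum_distrib_left mult.assoc)

lemma coeff_pairing_sum: "coeff_pairing w (\<Sum>i\<in>A. F i) = (\<Sum>i\<in>A. coeff_pairing w (F i))"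
  by (induction A rule: infinite_finite_induct) (simp_all add: coeff_pairing_add)

lemma coeff_pairing_monom_mult:
  "coeff_pairing w (monom c n * F) = c * (\<Sum>k\<le>degree F. coeff F k * w (n + k))"
proof -
  have "degree (monom c n * F) \<le> n + degree F"
    by (rule order.trans[OF degree_mult_le]) (simp add: degree_monom_le)
  then have "coeff_pairing w (monom c n * F) = (\<Sum>k\<le>n + degree F. coeff (monom c n * F) k * w k)"
    by (rule coeff_pairing_bound)
  also have "\<dots> = (\<Sum>k\<in>{n..n + degree F}. c * coeff F (k - n) * w k)"
    by (rule sum.mono_neutral_cong_right) (auto simp: coeff_monom_mult)
  also have "\<dots> = (\<Sum>k\<in>{0..degree F}. c * coeff F k * w (n + k))"
    using sum.shift_bounds_cl_nat_ivl[of "\<lambda>k. c * coeff F (k - n) * w k" 0 n "degree F"]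
    by (simp add: add.commute)
  finally show ?thesis
    by (simp add: sum_distrib_left mult.assoc atLeast0AtMost)
qed

text \<open>Against each monomial \<open>y ^ k\<close> of \<open>G\<close>, the factor
  \<open>(1 - y ^ p) ^ s\<close> takes an s-th difference of the sequence with step
  \<open>p\<close>, starting at \<open>k\<close>. Such a progression stays in one residue class mod
  \<open>p\<close>: it meets either only values of \<open>f\<close> or only zeros.\<close>

lemma fact_dvd_coeff_pairing:
  fixes f :: "int poly"
  assumes "p > 0"
  shows "fact s dvd coeff_pairing (\<lambda>k. if p dvd k then poly f (int (k div p)) else 0)
           ((1 - monom 1 p) ^ s * G)" (is "_ dvd coeff_pairing ?w _")
proof -
  have "(1 - monom 1 p :: int poly) ^ s = (\<Sum>j\<le>s. monom ((- 1) ^ j * int (s choose j)) (p * j))"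
  proof -
    have "(1 - monom 1 p :: int poly) ^ s = (monom (- 1) p + 1) ^ s"
      by (simp flip: minus_monom)
    also have "\<dots> = (\<Sum>j\<le>s. of_nat (s choose j) * monom (- 1) p ^ j)"
      by (simp add: binomial_ring)
    also have "\<dots> = (\<Sum>j\<le>s. monom ((- 1) ^ j * int (s choose j)) (p * j))"
      by (intro sum.cong refl)
        (simp add: monom_power of_nat_poly smult_monom mult.commute)
    finally show ?thesis .
  qed
  then have "coeff_pairing ?w ((1 - monom 1 p) ^ s * G)
      = (\<Sum>j\<le>s. ((- 1) ^ j * int (s choose j)) * (\<Sum>k\<le>degree G. coeff G k * ?w (p * j + k)))"
    by (simp add: sum_distrib_right coeff_pairing_sum coeff_pairing_monom_mult)
  also have "\<dots> = (\<Sum>k\<le>degree G. coeff G k * (\<Sum>j\<le>s. (- 1) ^ j * int (s choose j) * ?w (p * j + k)))"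
    unfolding sum_distrib_left by (subst sum.swap) (simp only: mult_ac)
  also have "fact s dvd \<dots>"
  proof (rule dvd_sum, rule dvd_mult)
    fix k
    show "fact s dvd (\<Sum>j\<le>s. (- 1) ^ j * int (s choose j) * ?w (p * j + k))"
    proof (cases "p dvd k")
      case True
      \<comment> \<open>Along the multiples of \<open>p\<close> the sequence is \<open>f\<close>
        shifted by \<open>k div p\<close>, again a polynomial in \<open>j\<close>.\<close>
      have w: "?w (p * j + k) = poly (f \<circ>\<^sub>p [:int (k div p), 1:]) (int j)" for j
        using True assms by (simp add: poly_pcompose dvd_add_right_iff add.commute)
      show ?thesis
        unfolding w by (rule fact_dvd_alternating_sum_poly)
    next
      case False
      then show ?thesis by (simp add: dvd_add_right_iff)
    qed
  qed
  finally show ?thesis .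
qed

section \<open>The p-th power of \<open>1 - y\<close> modulo \<open>p\<close>\<close>

lemma freshman_dream_poly:
  assumes "prime p"
  obtains g :: "int poly" where "[:1, - 1:] ^ p = 1 - monom 1 p + smult (int p) g"
proof -
  have p: "p > 0" "p \<noteq> 1" using assms prime_gt_0_nat by auto
  have "int p dvd coeff ([:1, - 1:] ^ p - (1 - monom 1 p)) i" for i
  proof -
    consider "i = 0" | "0 < i" "i < p" | "i = p" | "i > p" by linarith
    then show ?thesis
    proof cases
      case 1
      then show ?thesis using p by (simp add: coeff_linear_poly_power)
    next
      case 2
      then show ?thesis
        using assms by (simp add: coeff_linear_poly_power dvd_choose_prime)
    next
      case 3
      \<comment> \<open>The coefficient of the difference is \<open>(- 1) ^ p + 1\<close>: zero for
        odd \<open>p\<close>, and 2 for \<open>p = 2\<close>.\<close>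
      then show ?thesis
      proof (cases "p = 2")
        case False
        then have "odd p" using assms primes_dvd_imp_eq two_is_prime_nat by blast
        then show ?thesis using 3 p by (simp add: coeff_linear_poly_power)
      qed (simp add: coeff_linear_poly_power)
    next
      case 4
      have "degree ([:1, - 1 :: int:] ^ p) = p"
        by (simp add: degree_power_eq)
      then show ?thesis using 4 by (simp add: coeff_eq_0)
    qed
  qed
  then have "[:int p:] dvd [:1, - 1:] ^ p - (1 - monom 1 p)"
    unfolding const_poly_dvd_iff by blast
  then obtain g where "[:1, - 1:] ^ p - (1 - monom 1 p) = [:int p:] * g"
    by (auto elim: dvdE)
  then have "[:1, - 1:] ^ p = 1 - monom 1 p + smult (int p) g"
    by (simp add: algebra_simps)
  then show thesis by (rule that)
qed

section \<open>The power of a prime in a factorial\<close>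

lemma multiplicity_fact_Suc:
  assumes "prime (p::nat)"
  shows "multiplicity p (fact (Suc n)) = multiplicity p (Suc n) + multiplicity p (fact n)"
  using assms by (simp add: prime_elem_multiplicity_mult_distrib del: mult_Suc)

text \<open>Only the factors \<open>p * i\<close> with \<open>i \<le> n div p\<close> contribute,
  each one more than \<open>i\<close> does.\<close>

lemma multiplicity_fact_div:
  assumes "prime (p::nat)"
  shows "multiplicity p (fact n) = n div p + multiplicity p (fact (n div p))"
proof (induction n)
  case (Suc n)
  show ?case
  proof (cases "p dvd Suc n")
    case True
    then have "Suc n div p = Suc (n div p)"
      by (simp add: div_Suc dvd_eq_mod_eq_0)
    moreover have "multiplicity p (Suc n) = Suc (multiplicity p (Suc n div p))"
    proof -
      obtain k where k: "Suc n = p * k" using True by blast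
      then have "p \<noteq> 0" "k \<noteq> 0" by (auto intro: Nat.gr0I)
      moreover have "\<not> is_unit p" using assms not_prime_unit by blast
      ultimately show ?thesis unfolding k by (simp add: multiplicity_times_same)
    qed
    ultimately show ?thesis
      using Suc multiplicity_fact_Suc[OF assms] by simp
  next
    case False
    then show ?thesis
      using Suc multiplicity_fact_Suc[OF assms, of n]
      by (simp add: div_Suc dvd_eq_mod_eq_0 not_dvd_imp_multiplicity_0)
  qed
qed simp

lemma multiplicity_fact_le:
  assumes "prime (p::nat)"
  shows "multiplicity p (fact n) \<le> n div (p - 1)"
proof -
  \<comment> \<open>The product form keeps rounding out of the strong induction; division is
    restored at the end.\<close>
  have "(p - 1) * multiplicity p (fact n) \<le> n"
  proof (induction n rule: less_induct)
    case (less n)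
    show ?case
    proof (cases "n = 0")
      case False
      let ?a = "n div p"
      have p: "p > 1" using assms prime_gt_1_nat by blast
      have "(p - 1) * multiplicity p (fact n) = (p - 1) * ?a + (p - 1) * multiplicity p (fact ?a)"
        by (subst multiplicity_fact_div[OF assms]) (simp add: distrib_left)
      also have "\<dots> \<le> (p - 1) * ?a + ?a"
        using less.IH[of ?a] False p by simp
      also have "\<dots> = p * ?a"
        using p by (simp add: algebra_simps)
      also have "\<dots> \<le> n" by simp
      finally show ?thesis .
    qed simp
  qed
  then show ?thesis
    using prime_gt_1_nat[OF assms] by (simp add: less_eq_div_iff_mult_less_eq mult.commute)
qed

section \<open>Divisibility of the alternating sums\<close>

lemma prime_power_dvd_alternating_sum_multiples:
  fixes f :: "int poly"
  assumes "prime p"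
  shows "int p ^ multiplicity p (fact (m div p)) dvd
    (\<Sum>k\<in>{k. k \<le> m \<and> p dvd k}. (- 1) ^ k * int (m choose k) * poly f (int (k div p)))"
proof -
  define q where "q = m div p"
  define w where "w = (\<lambda>k. if p dvd k then poly f (int (k div p)) else 0)"
  have p0: "p > 0" using assms prime_gt_0_nat by blast
  obtain g :: "int poly" where g: "[:1, - 1:] ^ p = 1 - monom 1 p + smult (int p) g"
    using freshman_dream_poly[OF assms] .
  \<comment> \<open>Cofactors of \<open>(1 - y ^ p) ^ s\<close>, including the part of
    \<open>(1 - y) ^ m\<close> left over when \<open>p\<close> does not divide \<open>m\<close>;
    \<open>fact_dvd_coeff_pairing\<close> holds for any cofactor.\<close>
  define G where "G = (\<lambda>s. g ^ (q - s) * [:1, - 1:] ^ (m mod p))"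
  have "[:1, - 1 :: int:] ^ m = ([:1, - 1:] ^ p) ^ q * [:1, - 1:] ^ (m mod p)"
    unfolding q_def by (simp flip: power_mult power_add)
  also have "\<dots> = (\<Sum>s\<le>q. smult (int (q choose s) * int p ^ (q - s)) ((1 - monom 1 p) ^ s * G s))"
    unfolding g binomial_ring G_def sum_distrib_right
    by (intro sum.cong refl) (simp add: smult_power of_nat_poly mult_ac)
  finally have "coeff_pairing w ([:1, - 1:] ^ m)
      = (\<Sum>s\<le>q. int (q choose s) * int p ^ (q - s) * coeff_pairing w ((1 - monom 1 p) ^ s * G s))"
    by (simp add: coeff_pairing_sum coeff_pairing_smult)
  also have "int p ^ multiplicity p (fact q) dvd \<dots>"
  proof (rule dvd_sum)
    fix s assume "s \<in> {..q}"
    then have s: "s \<le> q" by simp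
    let ?C = "(q choose s) * fact s"
    \<comment> \<open>In \<open>fact q\<close> only the p-part of \<open>fact (q - s)\<close> has to
      be covered by the explicit factor \<open>p ^ (q - s)\<close>.\<close>
    have "fact q = ?C * fact (q - s)"
      using binomial_fact_lemma[OF s] by (simp add: mult_ac)
    then have "multiplicity p (fact q) = multiplicity p (?C * fact (q - s))"
      by (rule arg_cong)
    also have "\<dots> = multiplicity p ?C + multiplicity p (fact (q - s))"
      by (rule prime_elem_multiplicity_mult_distrib) (use s assms in auto)
    also have "multiplicity p (fact (q - s)) \<le> q - s"
      using multiplicity_fact_le[OF assms, of "q - s"] div_le_dividend le_trans by blast
    finally have "p ^ multiplicity p (fact q) dvd p ^ (multiplicity p ?C + (q - s))"
      by (intro le_imp_power_dvd) simp
    also have "\<dots> dvd ?C * p ^ (q - s)"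
      unfolding power_add by (intro mult_dvd_mono multiplicity_dvd dvd_refl)
    finally have "int (p ^ multiplicity p (fact q)) dvd int (?C * p ^ (q - s))"
      by (simp only: of_nat_dvd_iff)
    then have "int p ^ multiplicity p (fact q) dvd int (q choose s) * int p ^ (q - s) * fact s"
      by (simp add: mult_ac)
    also have "\<dots> dvd int (q choose s) * int p ^ (q - s) * coeff_pairing w ((1 - monom 1 p) ^ s * G s)"
      unfolding w_def by (intro mult_dvd_mono dvd_refl fact_dvd_coeff_pairing p0)
    finally show "int p ^ multiplicity p (fact q) dvd \<dots>" .
  qed
  also have "coeff_pairing w ([:1, - 1:] ^ m) = (\<Sum>k\<le>m. (- 1) ^ k * int (m choose k) * w k)"
    by (simp add: coeff_pairing_def degree_power_eq coeff_linear_poly_power mult.commute)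
  also have "\<dots> = (\<Sum>k\<in>{k. k \<le> m \<and> p dvd k}. (- 1) ^ k * int (m choose k) * poly f (int (k div p)))"
    unfolding w_def by (rule sum.mono_neutral_cong_right) auto
  finally show ?thesis unfolding q_def .
qed

text \<open>The exponent is \<open>h\<close> times the totient of
  \<open>p ^ (\<alpha> + 1)\<close>.\<close>

lemma prime_power_dvd_one_minus_power:
  assumes "prime p" and "\<not> p dvd j"
  shows "int p ^ (\<alpha> + 1) dvd 1 - int j ^ (h * (p - 1) * p ^ \<alpha>)"
proof -
  have "coprime j (p ^ (\<alpha> + 1))"
    using assms prime_imp_coprime coprime_commute coprime_power_right_iff by blast
  then have "[j ^ totient (p ^ (\<alpha> + 1)) = 1] (mod p ^ (\<alpha> + 1))"
    by (rule euler_theorem)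
  then have "[(j ^ totient (p ^ (\<alpha> + 1))) ^ h = 1 ^ h] (mod p ^ (\<alpha> + 1))"
    by (rule cong_pow)
  moreover have "totient (p ^ (\<alpha> + 1)) * h = h * (p - 1) * p ^ \<alpha>"
    using totient_prime_power_Suc[OF assms(1), of \<alpha>] by simp
  ultimately have "[j ^ (h * (p - 1) * p ^ \<alpha>) = 1] (mod p ^ (\<alpha> + 1))"
    by (simp only: power_one flip: power_mult)
  then have "[int (j ^ (h * (p - 1) * p ^ \<alpha>)) = int 1] (mod int (p ^ (\<alpha> + 1)))"
    by (simp only: cong_int_iff)
  then show ?thesis
    by (simp add: cong_iff_dvd_diff cong_sym_eq dvd_diff_commute)
qed

lemma prime_power_dvd_Stirling_sum:
  assumes "prime p"
  shows "int p ^ min (l * (\<alpha> + 1)) (r + multiplicity p (fact (m div p))) dvd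
    fact m * (\<Sum>k=0..l. int (l choose k) * (- 1) ^ k * int (Stirling (k * h * (p - 1) * p ^ \<alpha> + r) m))"
proof -
  define N where "N = h * (p - 1) * p ^ \<alpha>"
  define e where "e = min (l * (\<alpha> + 1)) (r + multiplicity p (fact (m div p)))"
  define t where "t = (\<lambda>j. (- 1) ^ j * int (m choose j) * (int j ^ r * (1 - int j ^ N) ^ l))"
  have binom: "(\<Sum>k\<le>l. int (l choose k) * (- 1) ^ k * int j ^ (k * N + r)) = int j ^ r * (1 - int j ^ N) ^ l" for j
  proof -
    have "(1 - int j ^ N) ^ l = (- (int j ^ N) + 1) ^ l" by simp
    also have "\<dots> = (\<Sum>k\<le>l. int (l choose k) * (- (int j ^ N)) ^ k)"
      by (subst binomial_ring) simp
    also have "\<dots> = (\<Sum>k\<le>l. int (l choose k) * (- 1) ^ k * int j ^ (k * N))"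
      by (intro sum.cong refl) (simp add: power_minus[of "int j ^ N"] mult.commute[of N] flip: power_mult)
    finally show ?thesis by (simp add: sum_distrib_left power_add mult_ac)
  qed
  have "fact m * (\<Sum>k=0..l. int (l choose k) * (- 1) ^ k * int (Stirling (k * N + r) m))
      = (\<Sum>k\<le>l. int (l choose k) * (- 1) ^ k * int (fact m * Stirling (k * N + r) m))"
    by (simp add: sum_distrib_left atLeast0AtMost mult_ac)
  also have "\<dots> = (\<Sum>j\<le>m. (- 1) ^ (m + j) * int (m choose j) *
      (\<Sum>k\<le>l. int (l choose k) * (- 1) ^ k * int j ^ (k * N + r)))"
    unfolding fact_Stirling_eq_alternating_sum sum_distrib_left
    by (subst sum.swap) (simp only: mult_ac)
  also have "\<dots> = (- 1) ^ m * (\<Sum>j\<le>m. t j)"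
    unfolding binom t_def by (simp add: sum_distrib_left power_add mult.assoc)
  also have "(\<Sum>j\<le>m. t j) = (\<Sum>j\<in>{j. j \<le> m \<and> p dvd j}. t j) + (\<Sum>j\<in>{j. j \<le> m \<and> \<not> p dvd j}. t j)"
    by (subst sum.union_disjoint[symmetric]) (auto intro: sum.cong)
  also have "int p ^ e dvd (- 1) ^ m * \<dots>"
  proof (intro dvd_mult dvd_add)
    \<comment> \<open>Chosen so that \<open>int (p * i) ^ r * (1 - int (p * i) ^ N) ^ l = int p ^ r
      * poly f (int i)\<close>.\<close>
    define f :: "int poly" where "f = monom 1 r * (1 - monom (int p ^ N) N) ^ l"
    have "int p ^ e dvd int p ^ (r + multiplicity p (fact (m div p)))"
      unfolding e_def by (intro le_imp_power_dvd) simp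
    also have "\<dots> dvd int p ^ r *
      (\<Sum>j\<in>{j. j \<le> m \<and> p dvd j}. (- 1) ^ j * int (m choose j) * poly f (int (j div p)))"
      unfolding power_add
      by (intro mult_dvd_mono dvd_refl prime_power_dvd_alternating_sum_multiples assms)
    also have "\<dots> = (\<Sum>j\<in>{j. j \<le> m \<and> p dvd j}. t j)"
      unfolding sum_distrib_left
    proof (intro sum.cong refl)
      fix j assume "j \<in> {j. j \<le> m \<and> p dvd j}"
      then obtain i where j: "j = p * i" by auto
      then show "int p ^ r * ((- 1) ^ j * int (m choose j) * poly f (int (j div p))) = t j"
        using prime_gt_0_nat[OF assms]
        by (simp add: t_def f_def poly_monom power_mult_distrib mult_ac)
    qed
    finally show "int p ^ e dvd (\<Sum>j\<in>{j. j \<le> m \<and> p dvd j}. t j)" .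
  next
    show "int p ^ e dvd (\<Sum>j\<in>{j. j \<le> m \<and> \<not> p dvd j}. t j)"
    proof (rule dvd_sum)
      fix j assume j: "j \<in> {j. j \<le> m \<and> \<not> p dvd j}"
      have "int p ^ e dvd int p ^ ((\<alpha> + 1) * l)"
        unfolding e_def mult.commute[of "\<alpha> + 1"] by (intro le_imp_power_dvd min.cobounded1)
      also have "\<dots> dvd (1 - int j ^ N) ^ l"
        unfolding power_mult[of "int p"] N_def
        using j by (intro dvd_power_same prime_power_dvd_one_minus_power assms) simp
      finally show "int p ^ e dvd t j"
        unfolding t_def by (intro dvd_mult)
    qed
  qed
  finally show ?thesis
    unfolding e_def N_def by (simp only: mult.assoc)
qed

section \<open>Translation to \<open>ord_p\<close> and the two claims\<close>

lemma ord_p_geI: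
  assumes "int p ^ a dvd x"
  shows "enat a \<le> ord_p p x"
  unfolding ord_p_def using assms by (intro SUP_upper) simp

text \<open>A factorial is nonzero, so the supremum is finite and attained.\<close>

lemma ord_p_fact:
  assumes "prime p"
  shows "ord_p p (fact n) = enat (multiplicity p (fact n))"
proof -
  have "int p ^ a dvd fact n \<longleftrightarrow> a \<le> multiplicity p (fact n)" for a
  proof -
    have "int p ^ a dvd fact n \<longleftrightarrow> int (p ^ a) dvd int (fact n)" by simp
    also have "\<dots> \<longleftrightarrow> p ^ a dvd fact n" by (rule of_nat_dvd_iff)
    also have "\<dots> \<longleftrightarrow> a \<le> multiplicity p (fact n)"
      using assms prime_gt_1_nat[OF assms] by (intro power_dvd_iff_le_multiplicity) auto
    finally show ?thesis .
  qed
  then show ?thesis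
    unfolding ord_p_def by (intro antisym SUP_least SUP_upper) auto
qed

theorem theorem1p4:
  fixes p n :: nat
  assumes "prime p" and "n > 0"
  shows "(\<forall>\<alpha> h l m :: nat.
            ord_p p (fact m * (\<Sum>k=0..l. int (l choose k) * (-1) ^ k *
                int (Stirling (k * h * (p - 1) * p ^ \<alpha> + (n - 1)) m)))
            \<ge> min (enat (l * (\<alpha> + 1)))
                 (enat (n - 1) + ord_p p (fact (m div p)))) \<and>
         (let N = n - 1 + n div (p * (p - 1)) in
            \<forall>L \<ge> N. e_p p n ((p - 1) * p ^ L + (n - 1))
              \<ge> enat (n - 1) + ord_p p (fact (n div p)))"
proof (intro conjI allI)
  fix \<alpha> h l m :: nat
  show "min (enat (l * (\<alpha> + 1))) (enat (n - 1) + ord_p p (fact (m div p))) \<le>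
    ord_p p (fact m * (\<Sum>k=0..l. int (l choose k) * (-1) ^ k *
                int (Stirling (k * h * (p - 1) * p ^ \<alpha> + (n - 1)) m)))"
    using ord_p_geI[OF prime_power_dvd_Stirling_sum[OF assms(1), of l \<alpha> "n - 1" m h]]
    by (simp add: ord_p_fact[OF assms(1)] min_enat_simps)
next
  have "enat (n - 1 + multiplicity p (fact (n div p))) \<le> e_p p n ((p - 1) * p ^ L + (n - 1))"
    if L: "n - 1 + n div (p * (p - 1)) \<le> L" for L
    unfolding e_p_def
  proof (intro INF_greatest ord_p_geI)
    fix m assume "m \<in> {n..}"
    then have m: "n \<le> m" by simp
    \<comment> \<open>With the bound on \<open>L\<close>, this makes \<open>L + 1\<close> exceed the
      target exponent, so both arguments of the \<open>min\<close> below are large enough.\<close>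
    have "multiplicity p (fact (n div p)) \<le> n div (p * (p - 1))"
      using multiplicity_fact_le[OF assms(1), of "n div p"] by (simp add: div_mult2_eq)
    moreover have "multiplicity p (fact (n div p)) \<le> multiplicity p (fact (m div p))"
      by (intro dvd_imp_multiplicity_le fact_dvd div_le_mono m) simp
    ultimately have "int p ^ (n - 1 + multiplicity p (fact (n div p))) dvd
        int p ^ min (1 * (L + 1)) (n - 1 + multiplicity p (fact (m div p)))"
      using L by (intro le_imp_power_dvd) simp
    also have "\<dots> dvd fact m * (\<Sum>k=0..1. int (1 choose k) * (- 1) ^ k *
        int (Stirling (k * 1 * (p - 1) * p ^ L + (n - 1)) m))"
      by (rule prime_power_dvd_Stirling_sum[OF assms(1)])
    \<comment> \<open>Only \<open>k = 1\<close> survives, with sign -1: at \<open>k = 0\<close> the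
      Stirling number is zero as \<open>n - 1 < m\<close>.\<close>
    also have "\<dots> = - int (fact m * Stirling ((p - 1) * p ^ L + (n - 1)) m)"
      using m assms(2) by simp
    finally show "int p ^ (n - 1 + multiplicity p (fact (n div p))) dvd
        int (fact m * Stirling ((p - 1) * p ^ L + (n - 1)) m)"
      by (simp only: dvd_minus_iff)
  qed
  then show "let N = n - 1 + n div (p * (p - 1)) in
            \<forall>L \<ge> N. e_p p n ((p - 1) * p ^ L + (n - 1))
              \<ge> enat (n - 1) + ord_p p (fact (n div p))"
    by (simp add: ord_p_fact[OF assms(1)] Let_def)
qed

end
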